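(* Let $f\in\mathrm{PCC}(\Omega)$ be such that $S_f$ is continuous on $\mathbb R$. Then $\partial^-S_f(\alpha_{f,\max}^* )=-\infty$ and $\partial^+S_f(\alpha_{f,\min}^* )=\infty$.
   Context: $\Omega=\{0,1\}^{\mathbb N}$ ($\mathbb N=\{1,2,\dots\}$) with the metric $d(\omega,\omega')=\sum_{k\ge1}|\omega_k-\omega'_k|2^{-k}$; $\sigma:\Omega\to\Omega$ is the one-sided shift, $(\sigma\omega)_k=\omega_{k+1}$. $C(\Omega)$ is the space of continuous functions $\Omega\to\mathbb R$. $\mathrm{PCC}^k(\Omega)$ is the set of functions $f\in C(\Omega)$ such that $f(\omega)$ depends only on the first $k$ coordinates $\omega_1,\dots,\omega_k$, and $\mathrm{PCC}(\Omega)=\bigcup_{k}\mathrm{PCC}^k(\Omega)$. For $f\in C(\Omega)$ and $\alpha\in\mathbb R$, $E_f(\alpha)=\{\omega\in\Omega:\lim_{N\to\infty}\frac1N\sum_{n=1}^N f(\sigma^n\omega)=\alpha\}$ and the Birkhoff spectrum is $S_f:\mathbb R\to[0,1]$, $S_f(\alpha)=\dim_H E_f(\alpha)$ (Hausdorff dimension with respect to $d$; $\dim_H\emptyset=0$). $\alpha_{f,\max}^*=\sup\{\alpha\in\mathbb R:E_f(\alpha)\ne\emptyset\}$ and $\alpha_{f,\min}^*=\inf\{\alpha\in\mathbb R:E_f(\alpha)\ne\emptyset\}$. For $\varphi:\mathbb R\to\mathbb R$, $\partial^-\varphi(\alpha)$ and $\partial^+\varphi(\alpha)$ denote the left-hand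 and right-hand derivatives of $\varphi$ at $\alpha$, as limits of difference quotients in $[-\infty,\infty]$. *)

theory Defs
  imports "HOL-Analysis.Analysis"
begin

text \<open>
  The space \<open>\<Omega> = {0,1}\<^sup>\<nat>\<close>, as a type of its own because the metric used here differs from the
  library's metric on countable products.  \<^term>\<open>True\<close> and \<^term>\<open>False\<close> stand for 1 and 0, and
  indices are shifted by one: \<open>coord \<omega> k\<close> is the coordinate \<open>\<omega>\<^sub>k\<^sub>+\<^sub>1\<close>, whose weight in the
  metric is \<open>2 ^ -(k + 1)\<close>.
\<close>

typedef binseq = "UNIV :: (nat \<Rightarrow> bool) set"
  morphisms coord Binseq ..

lemma coord_Binseq [simp]: "coord (Binseq x) = x"
  by (simp add: Binseq_inverse)

lemma binseq_eq_iff: "\<omega> = \<omega>' \<longleftrightarrow> (\<forall>k. coord \<omega> k = coord \<omega>' k)"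
  by (simp add: fun_eq_iff flip: coord_inject)

instantiation binseq :: metric_space
begin

definition dist_binseq :: "binseq \<Rightarrow> binseq \<Rightarrow> real" where
  "dist_binseq \<omega> \<omega>' =
     (\<Sum>k. \<bar>of_bool (coord \<omega> k) - of_bool (coord \<omega>' k)\<bar> * (1 / 2) ^ Suc k)"

definition uniformity_binseq :: "(binseq \<times> binseq) filter" where
  "uniformity_binseq = (INF e\<in>{0<..}. principal {(x, y). dist x y < e})"

definition open_binseq :: "binseq set \<Rightarrow> bool" where
  "open_binseq U = (\<forall>x\<in>U. eventually (\<lambda>(x', y). x' = x \<longrightarrow> y \<in> U) uniformity)"

lemma summable_dist_binseq:
  "summable (\<lambda>k. \<bar>of_bool (coord \<omega> k) - of_bool (coord \<omega>' k)\<bar> * (1 / 2 :: real) ^ Suc k)"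
proof (rule summable_comparison_test')
  show "summable (\<lambda>k. (1 / 2 :: real) ^ Suc k)"
    by (simp only: summable_Suc_iff) (simp add: summable_geometric)
  show "norm (\<bar>of_bool (coord \<omega> n) - of_bool (coord \<omega>' n)\<bar> * (1 / 2 :: real) ^ Suc n)
      \<le> (1 / 2) ^ Suc n" if "n \<ge> 0" for n
    by (auto simp: of_bool_def)
qed

instance
proof
  fix x y z :: binseq
  show "uniformity = (INF e\<in>{0<..}. principal {(x :: binseq, y). dist x y < e})"
    by (fact uniformity_binseq_def)
  show "open U = (\<forall>x\<in>U. eventually (\<lambda>(x', y). x' = x \<longrightarrow> y \<in> U) uniformity)"
    for U :: "binseq set"
    by (fact open_binseq_def)
  show "dist x y = 0 \<longleftrightarrow> x = y"
    unfolding dist_binseq_def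
    by (subst suminf_eq_zero_iff[OF summable_dist_binseq])
       (auto simp: binseq_eq_iff of_bool_def split: if_splits)
  show "dist x y \<le> dist x z + dist y z"
    unfolding dist_binseq_def
    by (subst suminf_add[OF summable_dist_binseq summable_dist_binseq],
        intro suminf_le summable_add summable_dist_binseq)
       (auto simp: of_bool_def)
qed

end

definition shift :: "binseq \<Rightarrow> binseq" where
  "shift \<omega> = Binseq (\<lambda>k. coord \<omega> (Suc k))"

definition PCCk :: "nat \<Rightarrow> (binseq \<Rightarrow> real) set" where
  "PCCk k = {f. continuous_on UNIV f \<and>
     (\<forall>\<omega> \<omega>'. (\<forall>i<k. coord \<omega> i = coord \<omega>' i) \<longrightarrow> f \<omega> = f \<omega>')}"

definition PCC :: "(binseq \<Rightarrow> real) set" where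
  "PCC = (\<Union>k. PCCk k)"


text \<open>
  Hausdorff measure and dimension.  The library has \<^prop>\<open>(0::real) powr 0 = 0\<close>; the gauge uses the
  convention \<open>0\<^sup>0 = 1\<close> on non-empty sets instead, so that \<open>hausdorff_measure 0\<close> is counting measure.
  Covering sets are required to be bounded because \<^const>\<open>diameter\<close> is meaningful only for those.
\<close>

definition hausdorff_gauge :: "real \<Rightarrow> 'a::metric_space set \<Rightarrow> real" where
  "hausdorff_gauge s U =
     (if U = {} then 0 else if s = 0 then 1 else diameter U powr s)"

definition hausdorff_premeasure :: "real \<Rightarrow> real \<Rightarrow> 'a::metric_space set \<Rightarrow> ennreal" where
  "hausdorff_premeasure s \<delta> E =
     (INF U\<in>{U :: nat \<Rightarrow> 'a set. (\<forall>i. bounded (U i) \<and> diameter (U i) \<le> \<delta>) \<and> E \<subseteq> (\<Union>i. U i)}.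
        \<Sum>i. ennreal (hausdorff_gauge s (U i)))"

definition hausdorff_measure :: "real \<Rightarrow> 'a::metric_space set \<Rightarrow> ennreal" where
  "hausdorff_measure s E = (SUP \<delta>\<in>{0<..}. hausdorff_premeasure s \<delta> E)"

definition hausdorff_dim :: "'a::metric_space set \<Rightarrow> ereal" where
  "hausdorff_dim E = Inf {ereal s | s. 0 \<le> s \<and> hausdorff_measure s E = 0}"


definition birkhoff_level :: "(binseq \<Rightarrow> real) \<Rightarrow> real \<Rightarrow> binseq set" where
  "birkhoff_level f \<alpha> =
     {\<omega>. (\<lambda>N. (1 / real N) * (\<Sum>n=1..N. f ((shift ^^ n) \<omega>))) \<longlonglongrightarrow> \<alpha>}"

text \<open>
  The conversion to a real number loses nothing, since dimensions of subsets of \<^typ>\<open>binseq\<close> lie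
  in \<open>[0, 1]\<close>; see \<open>hausdorff_dim_binseq\<close> below.
\<close>

definition birkhoff_spectrum :: "(binseq \<Rightarrow> real) \<Rightarrow> real \<Rightarrow> real" where
  "birkhoff_spectrum f \<alpha> = real_of_ereal (hausdorff_dim (birkhoff_level f \<alpha>))"

text \<open>
  For continuous \<open>f\<close> the set of attained averages is bounded (since \<open>f\<close> is) and non-empty (it
  contains the value of \<open>f\<close> at a fixed point of the shift), so the real supremum and infimum are
  the true ones; see \<open>attained_averages\<close> below for \<^const>\<open>PCC\<close>.
\<close>

definition alpha_max :: "(binseq \<Rightarrow> real) \<Rightarrow> real" where
  "alpha_max f = Sup {\<alpha>. birkhoff_level f \<alpha> \<noteq> {}}"

definition alpha_min :: "(binseq \<Rightarrow> real) \<Rightarrow> real" where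
  "alpha_min f = Inf {\<alpha>. birkhoff_level f \<alpha> \<noteq> {}}"

definition has_left_derivative :: "(real \<Rightarrow> real) \<Rightarrow> ereal \<Rightarrow> real \<Rightarrow> bool" where
  "has_left_derivative \<phi> D \<alpha> \<longleftrightarrow>
     ((\<lambda>\<beta>. ereal ((\<phi> \<beta> - \<phi> \<alpha>) / (\<beta> - \<alpha>))) \<longlongrightarrow> D) (at_left \<alpha>)"

definition has_right_derivative :: "(real \<Rightarrow> real) \<Rightarrow> ereal \<Rightarrow> real \<Rightarrow> bool" where
  "has_right_derivative \<phi> D \<alpha> \<longleftrightarrow>
     ((\<lambda>\<beta>. ereal ((\<phi> \<beta> - \<phi> \<alpha>) / (\<beta> - \<alpha>))) \<longlongrightarrow> D) (at_right \<alpha>)"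


lemma dist_binseq_le:
  assumes "\<And>i. i < n \<Longrightarrow> coord x i = coord y i"
  shows "dist x y \<le> (1 / 2) ^ n"
proof -
  let ?g = "\<lambda>k. \<bar>of_bool (coord x k) - of_bool (coord y k)\<bar> * (1 / 2 :: real) ^ Suc k"
  have s: "summable ?g" by (rule summable_dist_binseq)
  have geo: "(\<lambda>k. (1 / 2 :: real) ^ Suc (k + n)) sums ((1 / 2) ^ n)"
  proof -
    have "(\<lambda>k. (1 / 2 :: real) ^ Suc n * (1 / 2) ^ k) sums ((1 / 2) ^ Suc n * (1 / (1 - 1 / 2)))"
      by (intro sums_mult geometric_sums) auto
    thus ?thesis by (simp add: power_add algebra_simps)
  qed
  have "dist x y = (\<Sum>k. ?g (k + n)) + sum ?g {..<n}"
    unfolding dist_binseq_def by (rule suminf_split_initial_segment[OF s])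
  also have "sum ?g {..<n} = 0"
    using assms by (intro sum.neutral) auto
  also have "(\<Sum>k. ?g (k + n)) + 0 \<le> (\<Sum>k. (1 / 2 :: real) ^ Suc (k + n))"
  proof -
    have "(\<Sum>k. ?g (k + n)) \<le> (\<Sum>k. (1 / 2 :: real) ^ Suc (k + n))"
    proof (rule suminf_le)
      show "summable (\<lambda>k. ?g (k + n))" using s by (rule summable_ignore_initial_segment)
      show "summable (\<lambda>k. (1 / 2 :: real) ^ Suc (k + n))" using geo by (rule sums_summable)
    qed (auto simp: of_bool_def)
    thus ?thesis by simp
  qed
  also have "\<dots> = (1 / 2) ^ n" using geo by (rule sums_unique[symmetric])
  finally show ?thesis .
qed

lemma bounded_binseq: "bounded (A :: binseq set)"
proof -
  have "dist (Binseq (\<lambda>_. False)) y \<le> 1" for y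
    using dist_binseq_le[of 0 "Binseq (\<lambda>_. False)" y] by simp
  thus ?thesis unfolding bounded_def by blast
qed

lemma hausdorff_measure_binseq_eq_0:
  fixes E :: "binseq set"
  assumes "s > 1"
  shows "hausdorff_measure s E = 0"
proof -
  have "hausdorff_premeasure s \<delta> E \<le> ennreal \<epsilon>" if "\<delta> > 0" "\<epsilon> > 0" for \<delta> \<epsilon> :: real
  proof -
    have l1: "(\<lambda>n. (1 / 2 :: real) ^ n) \<longlonglongrightarrow> 0"
      by (rule LIMSEQ_realpow_zero) auto
    have q: "2 * ((1 / 2 :: real) powr s) < 1"
    proof -
      have "(1 / 2 :: real) powr s < (1 / 2) powr 1"
        using assms by (intro powr_less_mono') auto
      thus ?thesis by simp
    qed
    have l2: "(\<lambda>n. (2 * ((1 / 2 :: real) powr s)) ^ n) \<longlonglongrightarrow> 0"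
      using q by (intro LIMSEQ_realpow_zero) auto
    have "eventually (\<lambda>n. (1 / 2 :: real) ^ n < \<delta> \<and> (2 * ((1 / 2 :: real) powr s)) ^ n < \<epsilon>) sequentially"
      using order_tendstoD(2)[OF l1 that(1)] order_tendstoD(2)[OF l2 that(2)]
      by eventually_elim auto
    then obtain n where n: "(1 / 2 :: real) ^ n < \<delta>" "(2 * ((1 / 2 :: real) powr s)) ^ n < \<epsilon>"
      by (auto simp: eventually_sequentially)
    define U :: "nat \<Rightarrow> binseq set"
      where "U i = (if i < 2 ^ n then {\<omega>. \<forall>j<n. coord \<omega> j = bit i j} else {})" for i
    have diam: "diameter (U i) \<le> (1 / 2) ^ n" for i
    proof (cases "U i = {}")
      case False
      have "dist x y \<le> (1 / 2) ^ n" if "x \<in> U i" "y \<in> U i" for x y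
        using that by (intro dist_binseq_le) (auto simp: U_def split: if_splits)
      thus ?thesis unfolding diameter_def using False
        by (auto intro!: cSUP_least)
    qed simp
    have "\<omega> \<in> (\<Union>i. U i)" for \<omega>
    proof -
      define i :: nat where "i = horner_sum of_bool 2 (map (coord \<omega>) [0..<n])"
      have "i < 2 ^ n"
        using horner_sum_bound[of "map (coord \<omega>) [0..<n]", where 'a = nat] by (simp add: i_def)
      hence "\<omega> \<in> U i" by (auto simp: U_def i_def bit_horner_sum_bit_iff)
      thus ?thesis by blast
    qed
    hence "hausdorff_premeasure s \<delta> E \<le> (\<Sum>i. ennreal (hausdorff_gauge s (U i)))"
      unfolding hausdorff_premeasure_def using diam n(1)
      by (intro INF_lower) (auto simp: bounded_binseq intro: order.trans[OF _ less_imp_le])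
    also have "\<dots> = (\<Sum>i<2 ^ n. ennreal (hausdorff_gauge s (U i)))"
      by (intro suminf_finite) (auto simp: U_def hausdorff_gauge_def)
    also have "\<dots> \<le> (\<Sum>i<(2::nat) ^ n. ennreal (((1 / 2) ^ n) powr s))"
      using diam assms
      by (intro sum_mono ennreal_leI)
         (auto simp: hausdorff_gauge_def intro!: powr_mono2 diameter_ge_0 bounded_binseq)
    also have "\<dots> = ennreal (2 ^ n * ((1 / 2) ^ n) powr s)"
      by (simp add: ennreal_mult flip: ennreal_power)
    also have "2 ^ n * ((1 / 2 :: real) ^ n) powr s = (2 * ((1 / 2 :: real) powr s)) ^ n"
    proof -
      have "((1 / 2 :: real) ^ n) powr s = ((1 / 2 :: real) powr s) ^ n"
        by (simp add: powr_powr mult.commute flip: powr_realpow)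
      thus ?thesis by (simp only: power_mult_distrib)
    qed
    also have "ennreal ((2 * ((1 / 2 :: real) powr s)) ^ n) \<le> ennreal \<epsilon>"
      using n(2) by (intro ennreal_leI) auto
    finally show ?thesis .
  qed
  hence "hausdorff_premeasure s \<delta> E = 0" if "\<delta> > 0" for \<delta>
    using that by (metis ennreal_le_epsilon add_0 le_zero_eq)
  thus ?thesis unfolding hausdorff_measure_def by simp
qed

lemma hausdorff_dim_binseq:
  fixes E :: "binseq set"
  shows "0 \<le> hausdorff_dim E" "hausdorff_dim E \<le> 1"
proof -
  show "0 \<le> hausdorff_dim E"
    unfolding hausdorff_dim_def by (intro Inf_greatest) auto
  show "hausdorff_dim E \<le> 1"
  proof (rule ereal_le_epsilon2)
    fix e :: real assume "0 < e"
    hence "hausdorff_dim E \<le> ereal (1 + e)"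
      unfolding hausdorff_dim_def
      by (intro Inf_lower) (auto intro!: exI[of _ "1 + e"] hausdorff_measure_binseq_eq_0)
    thus "hausdorff_dim E \<le> 1 + ereal e" by (simp add: one_ereal_def)
  qed
qed

lemma hausdorff_dim_empty: "hausdorff_dim {} = 0"
proof (rule antisym)
  have "hausdorff_premeasure 0 \<delta> ({} :: 'a set) = 0" if "\<delta> > 0" for \<delta>
  proof -
    have "hausdorff_premeasure 0 \<delta> ({} :: 'a set)
        \<le> (\<Sum>i::nat. ennreal (hausdorff_gauge 0 ({} :: 'a set)))"
      unfolding hausdorff_premeasure_def using that
      by (intro INF_lower2[where i = "\<lambda>_. {}"]) auto
    thus ?thesis by (simp add: hausdorff_gauge_def)
  qed
  hence "hausdorff_measure 0 ({} :: 'a set) = 0"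
    by (simp add: hausdorff_measure_def)
  thus "hausdorff_dim ({} :: 'a set) \<le> 0"
    unfolding hausdorff_dim_def by (intro Inf_lower) (auto simp: zero_ereal_def)
  show "0 \<le> hausdorff_dim ({} :: 'a set)"
    unfolding hausdorff_dim_def by (intro Inf_greatest) auto
qed

lemma attained_averages:
  assumes "f \<in> PCC"
  shows "{\<alpha>. birkhoff_level f \<alpha> \<noteq> {}} \<noteq> {}"
    and "bdd_above {\<alpha>. birkhoff_level f \<alpha> \<noteq> {}}"
    and "bdd_below {\<alpha>. birkhoff_level f \<alpha> \<noteq> {}}"
proof -
  obtain k where k: "\<And>\<omega> \<omega>'. (\<And>i. i < k \<Longrightarrow> coord \<omega> i = coord \<omega>' i) \<Longrightarrow> f \<omega> = f \<omega>'"
    using assms unfolding PCC_def PCCk_def by blast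
  define g where "g bs = f (Binseq (\<lambda>i. i < k \<and> bs ! i))" for bs
  have "f \<omega> = g (map (coord \<omega>) [0..<k])" for \<omega>
    unfolding g_def by (rule k) auto
  hence "range f \<subseteq> g ` {bs. set bs \<subseteq> UNIV \<and> length bs = k}" by auto
  hence "finite (range f)"
    by (rule finite_subset) (intro finite_imageI finite_lists_length_eq finite)
  hence "bounded (range f)" by (rule finite_imp_bounded)
  then obtain B where B: "\<And>\<omega>. \<bar>f \<omega>\<bar> \<le> B" unfolding bounded_iff by auto
  have bound: "\<bar>\<alpha>\<bar> \<le> B" if "\<omega> \<in> birkhoff_level f \<alpha>" for \<alpha> \<omega>
  proof -
    let ?A = "\<lambda>N. (1 / real N) * (\<Sum>n=1..N. f ((shift ^^ n) \<omega>))"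
    have lim: "(\<lambda>N. \<bar>?A N\<bar>) \<longlonglongrightarrow> \<bar>\<alpha>\<bar>"
      using that unfolding birkhoff_level_def by (intro tendsto_rabs) simp
    have "\<bar>?A N\<bar> \<le> B" if "N \<ge> 1" for N
    proof -
      have "\<bar>\<Sum>n=1..N. f ((shift ^^ n) \<omega>)\<bar> \<le> (\<Sum>n=1..N. \<bar>f ((shift ^^ n) \<omega>)\<bar>)"
        by (rule sum_abs)
      also have "\<dots> \<le> (\<Sum>n=1..N. B)" by (intro sum_mono B)
      finally show ?thesis using that by (simp add: abs_mult field_simps)
    qed
    thus ?thesis by (intro LIMSEQ_le_const2[OF lim]) auto
  qed
  define z where "z = Binseq (\<lambda>_. False)"
  have "shift z = z" by (simp add: z_def shift_def)
  hence iter: "(shift ^^ n) z = z" for n by (induction n) auto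
  have "(\<lambda>N. (1 / real N) * (\<Sum>n=1..N. f ((shift ^^ n) z))) \<longlonglongrightarrow> f z"
    by (rule tendsto_eventually, rule eventually_sequentiallyI[of 1]) (simp add: iter)
  hence "z \<in> birkhoff_level f (f z)" by (simp add: birkhoff_level_def)
  thus "{\<alpha>. birkhoff_level f \<alpha> \<noteq> {}} \<noteq> {}" by blast
  show "bdd_above {\<alpha>. birkhoff_level f \<alpha> \<noteq> {}}"
    by (rule bdd_aboveI[of _ B]) (use bound in fastforce)
  show "bdd_below {\<alpha>. birkhoff_level f \<alpha> \<noteq> {}}"
    by (rule bdd_belowI[of _ "- B"]) (use bound in fastforce)
qed

end

theory Submission
  imports Defs
begin

text \<open>
  The maximal average \<open>\<alpha>\<close> is attained by a periodic sequence \<open>a\<close>; let \<open>L\<close> be a period of \<open>a\<close>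
  exceeding the number of coordinates seen by \<open>f\<close>.  Flipping the last letter of an \<open>L\<close>-block of \<open>a\<close>
  lowers the Birkhoff sum by a constant \<open>c\<close>, independently of the other blocks, so flipping blocks
  with density \<open>q\<close> gives the average \<open>\<alpha> - c q / L\<close>.  If \<open>q \<le> 2\<^sup>-\<^sup>m\<close>, the flipped blocks can be spread
  so that each has \<open>2\<^sup>m\<close> possible places, which encodes \<open>m\<close> bits per \<open>L / q\<close> coordinates; the
  decoding is Hoelder with exponent \<open>m q / L\<close>, hence \<open>S\<^sub>f(\<alpha> - c q / L) \<ge> m q / L\<close>.  Continuity forces
  \<open>S\<^sub>f(\<alpha>) = 0\<close>, so \<open>c > 0\<close>, and the difference quotient at distance \<open>c q / L\<close> is at most \<open>- m / c\<close>
  with \<open>m\<close> arbitrary.  The minimum is treated by passing to \<open>- f\<close>.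
\<close>

subsection \<open>A lower bound for the Hausdorff dimension\<close>

text \<open>The inverse of \<open>\<psi>\<close> is Hoelder, so a cover of \<open>E\<close> with
  small gauge sum would pull back to a cover of the unit interval with small total length.\<close>

lemma hausdorff_dim_ge_Hoelder:
  fixes \<psi> :: "real \<Rightarrow> 'a::metric_space"
  assumes C: "C > 0"
    and sub: "\<psi> ` {0..<1} \<subseteq> E"
    and hoelder: "\<And>x y. x \<in> {0..<1} \<Longrightarrow> y \<in> {0..<1} \<Longrightarrow> \<bar>x - y\<bar> \<le> C * dist (\<psi> x) (\<psi> y) powr s"
  shows "ereal s \<le> hausdorff_dim E"
  unfolding hausdorff_dim_def
proof (rule Inf_greatest, clarsimp)
  fix t assume t: "0 \<le> t" and null: "hausdorff_measure t E = 0"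
  show "s \<le> t"
  proof (rule ccontr)
    assume "\<not> s \<le> t"
    hence ts: "t < s" by simp
    \<comment> \<open>A bound at the single scale 1 suffices, because the measure is a supremum over
      scales. Diameters at most 1 also let the exponent \<open>s\<close> be replaced by the smaller
      \<open>t\<close>.\<close>
    have "ennreal (1 / (2 * C)) \<le> hausdorff_premeasure t 1 E"
      unfolding hausdorff_premeasure_def
    proof (rule INF_greatest, clarsimp)
      fix U :: "nat \<Rightarrow> 'a set"
      assume U: "\<forall>i. bounded (U i) \<and> diameter (U i) \<le> 1" and cover: "E \<subseteq> (\<Union>i. U i)"
      define g where "g i = hausdorff_gauge t (U i)" for i
      have g0: "g i \<ge> 0" for i by (simp add: g_def hausdorff_gauge_def)
      define V where "V i = {x \<in> {0..<1}. \<psi> x \<in> U i}" for i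
      have V: "\<bar>x - y\<bar> \<le> C * g i" if "x \<in> V i" "y \<in> V i" for x y i
      proof -
        have d: "dist (\<psi> x) (\<psi> y) \<le> diameter (U i)"
          using that U by (intro diameter_bounded_bound) (auto simp: V_def)
        have "\<bar>x - y\<bar> \<le> C * dist (\<psi> x) (\<psi> y) powr s"
          using that by (intro hoelder) (auto simp: V_def)
        also have "\<dots> \<le> C * dist (\<psi> x) (\<psi> y) powr t"
          using C ts order.trans[OF d] U by (intro mult_left_mono powr_mono') simp_all
        also have "\<dots> \<le> C * g i"
        proof (intro mult_left_mono)
          show "dist (\<psi> x) (\<psi> y) powr t \<le> g i"
            using that d t
            by (auto simp: g_def hausdorff_gauge_def V_def intro: powr_mono2)
        qed (use C in auto)
        finally show ?thesis .
      qed
      \<comment> \<open>Since \<open>\<psi>\<close> is arbitrary, \<open>V i\<close> may fail to be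
        measurable. It is enclosed in an interval of length \<open>2 * C * g i\<close> centred at
        one of its points, whence the factor 2.\<close>
      define W where "W i = (if V i = {} then {} else cball (SOME x. x \<in> V i) (C * g i))" for i
      have VW: "V i \<subseteq> W i" for i
      proof (cases "V i = {}")
        case False
        hence "(SOME x. x \<in> V i) \<in> V i" by (simp add: some_in_eq)
        thus ?thesis using V by (auto simp: W_def dist_real_def)
      qed auto
      have "{0..<1} \<subseteq> (\<Union>i. V i)"
      proof
        fix x :: real assume "x \<in> {0..<1}"
        moreover from this have "\<psi> x \<in> (\<Union>i. U i)" using sub cover by blast
        ultimately show "x \<in> (\<Union>i. V i)" by (simp add: V_def)
      qed
      also have "\<dots> \<subseteq> (\<Union>i. W i)" by (rule UN_mono[OF order_refl VW])
      finally have "{0..<1} \<subseteq> (\<Union>i. W i)" .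
      hence "emeasure lborel {0..<1::real} \<le> emeasure lborel (\<Union>i. W i)"
        by (intro emeasure_mono) (auto simp: W_def)
      also have "\<dots> \<le> (\<Sum>i. emeasure lborel (W i))"
        by (intro emeasure_subadditive_countably) (auto simp: W_def)
      also have "\<dots> \<le> (\<Sum>i. ennreal (2 * C) * ennreal (g i))"
      proof (intro suminf_le)
        show "emeasure lborel (W i) \<le> ennreal (2 * C) * ennreal (g i)" for i
          using C g0[of i] by (auto simp: W_def cball_eq_atLeastAtMost simp flip: ennreal_mult)
      qed auto
      also have "\<dots> = ennreal (2 * C) * (\<Sum>i. ennreal (g i))" by simp
      finally have "1 \<le> ennreal (2 * C) * (\<Sum>i. ennreal (g i))" by simp
      hence "ennreal (1 / (2 * C)) * 1 \<le> ennreal (1 / (2 * C)) * (ennreal (2 * C) * (\<Sum>i. ennreal (g i)))"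
        by (intro mult_left_mono) auto
      also have "\<dots> = (\<Sum>i. ennreal (g i))"
        unfolding mult.assoc[symmetric] using C by (simp flip: ennreal_mult)
      finally show "ennreal (1 / (2 * C)) \<le> (\<Sum>i. ennreal (hausdorff_gauge t (U i)))"
        by (simp add: g_def)
    qed
    also have "\<dots> \<le> hausdorff_measure t E"
      unfolding hausdorff_measure_def by (intro SUP_upper) auto
    finally show False using null C by simp
  qed
qed

lemma dist_binseq_ge:
  assumes "coord x i \<noteq> coord y i"
  shows "(1 / 2) ^ Suc i \<le> dist x y"
proof -
  have "(1 / 2) ^ Suc i = (\<Sum>k\<in>{i}. \<bar>of_bool (coord x k) - of_bool (coord y k)\<bar> * (1 / 2 :: real) ^ Suc k)"
    using assms by (auto simp: of_bool_def)
  also have "\<dots> \<le> dist x y"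
    unfolding dist_binseq_def by (intro sum_le_suminf summable_dist_binseq) auto
  finally show ?thesis .
qed

text \<open>The remainders are base-\<open>Q\<close> digits. Integer division by \<open>Q\<close>
  drops the last digit, so by induction equal digits give equal integer parts of
  \<open>x * Q ^ J\<close> and \<open>y * Q ^ J\<close>.\<close>

lemma digits_agree_imp_close:
  fixes x y :: real and Q :: nat
  assumes Q: "Q > 0" and x: "x \<in> {0..<1}" and y: "y \<in> {0..<1}"
    and eq: "\<And>j. j < J \<Longrightarrow> nat \<lfloor>x * real Q ^ Suc j\<rfloor> mod Q = nat \<lfloor>y * real Q ^ Suc j\<rfloor> mod Q"
  shows "\<bar>x - y\<bar> \<le> 1 / real Q ^ J"
proof -
  have div: "nat \<lfloor>u * real Q ^ Suc j\<rfloor> div Q = nat \<lfloor>u * real Q ^ j\<rfloor>" if "u \<ge> 0" for u :: real and j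
  proof -
    have "\<lfloor>u * real Q ^ Suc j\<rfloor> div int Q = \<lfloor>u * real Q ^ Suc j / real_of_int (int Q)\<rfloor>"
      by (rule floor_divide_real_eq_div[symmetric]) simp
    also have "\<dots> = \<lfloor>u * real Q ^ j\<rfloor>" using Q by (simp add: field_simps)
    finally show ?thesis using that by (metis nat_div_as_int int_nat_eq nat_int
      floor_mono floor_zero mult_nonneg_nonneg of_nat_0_le_iff zero_le_power zero_le_floor)
  qed
  have "nat \<lfloor>x * real Q ^ j\<rfloor> = nat \<lfloor>y * real Q ^ j\<rfloor>" if "j \<le> J" for j
    using that
  proof (induction j)
    case 0
    thus ?case using x y by (auto simp: floor_eq_iff)
  next
    case (Suc j)
    have "nat \<lfloor>x * real Q ^ Suc j\<rfloor> div Q = nat \<lfloor>y * real Q ^ Suc j\<rfloor> div Q"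
      using Suc x y by (simp add: div del: power_Suc)
    with eq[of j] Suc.prems show ?case
      by (metis Suc_le_lessD mult_div_mod_eq)
  qed
  from this[OF order_refl] have "\<lfloor>x * real Q ^ J\<rfloor> = \<lfloor>y * real Q ^ J\<rfloor>"
    using x y by (simp add: eq_nat_nat_iff)
  hence "\<bar>x * real Q ^ J - y * real Q ^ J\<bar> \<le> 1" by linarith
  hence "\<bar>x - y\<bar> * real Q ^ J \<le> 1" by (simp add: abs_mult flip: left_diff_distrib)
  thus ?thesis using Q by (simp add: field_simps)
qed

subsection \<open>Birkhoff sums\<close>

definition depends_on_first :: "nat \<Rightarrow> (binseq \<Rightarrow> real) \<Rightarrow> bool" where
  "depends_on_first k f \<longleftrightarrow> (\<forall>\<omega> \<omega>'. (\<forall>i<k. coord \<omega> i = coord \<omega>' i) \<longrightarrow> f \<omega> = f \<omega>')"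

text \<open>Unlike in \<open>birkhoff_level\<close>, the summation starts at 0, so that it splits at
  the block boundaries \<open>j * L\<close>. The change of index costs a bounded boundary
  term.\<close>

definition birkhoff_sum :: "(binseq \<Rightarrow> real) \<Rightarrow> nat \<Rightarrow> binseq \<Rightarrow> real" where
  "birkhoff_sum f N \<omega> = (\<Sum>n<N. f ((shift ^^ n) \<omega>))"

definition periodic_seq :: "bool list \<Rightarrow> binseq" where
  "periodic_seq v = Binseq (\<lambda>i. v ! (i mod length v))"

lemma coord_funpow_shift [simp]: "coord ((shift ^^ n) \<omega>) i = coord \<omega> (n + i)"
  by (induction n arbitrary: i) (auto simp: shift_def)

lemma birkhoff_sum_add:
  "birkhoff_sum f (M + N) \<omega> = birkhoff_sum f M \<omega> + birkhoff_sum f N ((shift ^^ M) \<omega>)"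
  unfolding birkhoff_sum_def
  by (induction N) (simp_all add: add.commute flip: funpow_add[THEN fun_cong, unfolded o_apply])

lemma depends_on_firstD:
  "depends_on_first k f \<Longrightarrow> (\<And>i. i < k \<Longrightarrow> coord \<omega> i = coord \<omega>' i) \<Longrightarrow> f \<omega> = f \<omega>'"
  unfolding depends_on_first_def by blast

lemma depends_on_first_bounded:
  assumes "depends_on_first k f"
  obtains B where "B \<ge> 0" "\<forall>\<omega>. \<bar>f \<omega>\<bar> \<le> B"
proof -
  define g where "g bs = f (Binseq (\<lambda>i. i < k \<and> bs ! i))" for bs
  have "f \<omega> = g (map (coord \<omega>) [0..<k])" for \<omega>
    unfolding g_def by (rule depends_on_firstD[OF assms]) auto
  hence "range f \<subseteq> g ` {bs. set bs \<subseteq> UNIV \<and> length bs = k}" by auto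
  hence "finite (range f)"
    by (rule finite_subset) (intro finite_imageI finite_lists_length_eq finite)
  then obtain B where "\<And>\<omega>. \<bar>f \<omega>\<bar> \<le> B"
    using finite_imp_bounded[of "range f"] unfolding bounded_iff by auto
  thus ?thesis using that[of "max B 0"] by (meson max.cobounded2 max.coboundedI1)
qed

lemma tendsto_average:
  fixes S :: "nat \<Rightarrow> real"
  assumes "\<And>N. \<bar>S N - real N * \<alpha>\<bar> \<le> D"
  shows "(\<lambda>N. (1 / real N) * S N) \<longlonglongrightarrow> \<alpha>"
proof -
  have "(\<lambda>N. (1 / real N) * S N - \<alpha>) \<longlonglongrightarrow> 0"
  proof (rule Lim_null_comparison)
    show "eventually (\<lambda>N. norm ((1 / real N) * S N - \<alpha>) \<le> D * (1 / real N)) sequentially"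
    proof (rule eventually_sequentiallyI[of 1])
      fix N :: nat assume "1 \<le> N"
      hence "(1 / real N) * S N - \<alpha> = (S N - real N * \<alpha>) / real N" by (simp add: field_simps)
      thus "norm ((1 / real N) * S N - \<alpha>) \<le> D * (1 / real N)"
        using assms[of N] by (simp add: abs_divide divide_right_mono)
    qed
    show "(\<lambda>N. D * (1 / real N)) \<longlonglongrightarrow> 0"
      using tendsto_mult_right[OF lim_1_over_n, of D] by simp
  qed
  thus ?thesis by (simp add: LIM_zero_iff)
qed

lemma sum_shift_conv_birkhoff_sum:
  "(\<Sum>n=1..N. f ((shift ^^ n) \<omega>)) = birkhoff_sum f N \<omega> + f ((shift ^^ N) \<omega>) - f \<omega>"
  by (induction N) (auto simp: birkhoff_sum_def)

lemma mem_birkhoff_levelI: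
  assumes B: "\<And>\<omega>. \<bar>f \<omega>\<bar> \<le> B" and "\<And>N. \<bar>birkhoff_sum f N \<omega> - real N * \<alpha>\<bar> \<le> D"
  shows "\<omega> \<in> birkhoff_level f \<alpha>"
  unfolding birkhoff_level_def mem_Collect_eq
proof (rule tendsto_average[where D = "D + 2 * B"])
  show "\<bar>(\<Sum>n=1..N. f ((shift ^^ n) \<omega>)) - real N * \<alpha>\<bar> \<le> D + 2 * B" for N
    unfolding sum_shift_conv_birkhoff_sum
    using assms(2)[of N] B[of \<omega>] B[of "(shift ^^ N) \<omega>"] by linarith
qed

lemma birkhoff_level_le:
  assumes B: "\<And>\<omega>. \<bar>f \<omega>\<bar> \<le> B" and "\<And>N. birkhoff_sum f N \<omega> \<le> real N * M + D"
    and "\<omega> \<in> birkhoff_level f \<alpha>"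
  shows "\<alpha> \<le> M"
proof (rule LIMSEQ_le)
  show "(\<lambda>N. (1 / real N) * (\<Sum>n=1..N. f ((shift ^^ n) \<omega>))) \<longlonglongrightarrow> \<alpha>"
    using assms(3) by (simp add: birkhoff_level_def)
  show "(\<lambda>N. (1 / real N) * (real N * M + D + 2 * B)) \<longlonglongrightarrow> M"
    by (rule tendsto_average[where D = "\<bar>D + 2 * B\<bar>"]) simp
  show "\<exists>N0. \<forall>N\<ge>N0. (1 / real N) * (\<Sum>n=1..N. f ((shift ^^ n) \<omega>)) \<le> (1 / real N) * (real N * M + D + 2 * B)"
  proof (intro exI allI impI mult_left_mono)
    show "(\<Sum>n=1..N. f ((shift ^^ n) \<omega>)) \<le> real N * M + D + 2 * B" for N
      unfolding sum_shift_conv_birkhoff_sum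
      using assms(2)[of N] B[of \<omega>] B[of "(shift ^^ N) \<omega>"] by linarith
  qed auto
qed

text \<open>A repeated window of length \<open>k\<close> bounds a cycle, which can be excised without changing the
  remaining values of \<open>f\<close>.\<close>

lemma birkhoff_sum_le_cycle_mean:
  assumes dep: "depends_on_first k f"
    and cyc: "\<And>v. v \<noteq> [] \<Longrightarrow> length v \<le> 2 ^ k \<Longrightarrow>
      birkhoff_sum f (length v) (periodic_seq v) \<le> real (length v) * M"
    and D: "\<And>\<omega>. f \<omega> \<le> M + D" "D \<ge> 0"
  shows "birkhoff_sum f N \<omega> \<le> real N * M + 2 ^ k * D"
proof (induction N arbitrary: \<omega> rule: less_induct)
  case (less N)
  show ?case
  proof (cases "N \<le> 2 ^ k")
    \<comment> \<open>Short sums are charged \<open>D\<close> per term. Excised cycles are charged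
      nothing, so the error never exceeds \<open>2 ^ k * D\<close>.\<close>
    case True
    have "birkhoff_sum f N \<omega> \<le> (\<Sum>n<N. M + D)"
      unfolding birkhoff_sum_def by (intro sum_mono D)
    also have "\<dots> = real N * M + real N * D" by (simp add: algebra_simps)
    also have "real N \<le> 2 ^ k"
      using True by (metis of_nat_le_iff of_nat_numeral of_nat_power)
    hence "real N * D \<le> 2 ^ k * D" using D(2) by (rule mult_right_mono)
    finally show ?thesis by simp
  next
    case False
    define w where "w n = map (\<lambda>i. coord \<omega> (n + i)) [0..<k]" for n
    \<comment> \<open>Pigeonhole: \<open>2 ^ k + 1\<close> positions, but only \<open>2 ^ k\<close>
      words of length \<open>k\<close>.\<close>
    have "\<not> inj_on w {..2 ^ k}"
    proof
      assume "inj_on w {..2 ^ k}"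
      moreover have "w ` {..2 ^ k} \<subseteq> {bs. set bs \<subseteq> UNIV \<and> length bs = k}" by (auto simp: w_def)
      moreover have "card {bs :: bool list. set bs \<subseteq> UNIV \<and> length bs = k} = 2 ^ k"
        by (subst card_lists_length_eq) auto
      moreover have "finite {bs :: bool list. set bs \<subseteq> UNIV \<and> length bs = k}"
        by (intro finite_lists_length_eq finite)
      ultimately have "card {..2 ^ k :: nat} \<le> 2 ^ k"
        using card_inj_on_le[of w "{..2 ^ k}" "{bs. set bs \<subseteq> UNIV \<and> length bs = k}"] by simp
      thus False by simp
    qed
    then obtain i j where ij: "i < j" "j \<le> 2 ^ k" "w i = w j"
      unfolding inj_on_def by (metis atMost_iff less_linear)
    have same: "coord \<omega> (i + t) = coord \<omega> (j + t)" if "t < k" for t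
    proof -
      have "w i ! t = w j ! t" by (simp add: ij)
      thus ?thesis using that by (simp add: w_def)
    qed
    define p where "p = j - i"
    have p: "p > 0" "j = i + p" "p \<le> 2 ^ k" "i + p < N" using ij False by (auto simp: p_def)
    define v where "v = map (\<lambda>t. coord \<omega> (i + t)) [0..<p]"
    have v: "length v = p" "v \<noteq> []" using p by (auto simp: v_def)
    \<comment> \<open>Equality of the windows at \<open>i\<close> and \<open>j\<close> prolongs the
      period \<open>p\<close> by \<open>k\<close> letters past the cycle, which is as far as
      \<open>f\<close> looks from positions inside it.\<close>
    have periodic: "coord \<omega> (i + t) = v ! (t mod p)" if "t < p + k" for t
      using that
    proof (induction t rule: less_induct)
      case (less t)
      show ?case
      proof (cases "t < p")
        case True thus ?thesis by (simp add: v_def)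
      next
        case False
        hence "coord \<omega> (i + t) = coord \<omega> (i + (t - p))"
          using same[of "t - p"] less.prems p by (simp add: add.assoc)
        also have "\<dots> = v ! ((t - p) mod p)" using False p less.prems by (intro less.IH) auto
        finally show ?thesis using False by (simp add: le_mod_geq)
      qed
    qed
    \<comment> \<open>Windows starting before \<open>i\<close> may reach into the excised stretch.
      They read the same letters after the excision because the windows at \<open>i\<close> and
      \<open>j\<close> agree.\<close>
    define \<omega>' where "\<omega>' = Binseq (\<lambda>n. if n < i then coord \<omega> n else coord \<omega> (n + p))"
    have s1: "f ((shift ^^ n) \<omega>) = f ((shift ^^ n) \<omega>')" if "n < i" for n
    proof (rule depends_on_firstD[OF dep])
      fix t assume "t < k"
      thus "coord ((shift ^^ n) \<omega>) t = coord ((shift ^^ n) \<omega>') t"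
        using that same[of "n + t - i"] by (auto simp: \<omega>'_def p(2) add_ac)
    qed
    have s2: "f ((shift ^^ (i + n)) \<omega>) = f ((shift ^^ n) (periodic_seq v))" if "n < p" for n
    proof (rule depends_on_firstD[OF dep])
      fix t assume "t < k"
      thus "coord ((shift ^^ (i + n)) \<omega>) t = coord ((shift ^^ n) (periodic_seq v)) t"
        using that periodic[of "n + t"] by (simp add: periodic_seq_def v add_ac)
    qed
    have s3: "f ((shift ^^ (i + p + n)) \<omega>) = f ((shift ^^ (i + n)) \<omega>')" for n
      by (rule depends_on_firstD[OF dep]) (auto simp: \<omega>'_def add_ac)
    have split: "(\<Sum>n<a + b. h n) = (\<Sum>n<a. h n) + (\<Sum>n<b. h (a + n))" for a b and h :: "nat \<Rightarrow> real"
      by (induction b) (auto simp: add_ac)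
    have "birkhoff_sum f (i + p + (N - (i + p))) \<omega> = birkhoff_sum f p (periodic_seq v) + birkhoff_sum f (i + (N - (i + p))) \<omega>'"
      unfolding birkhoff_sum_def split by (simp add: s1 s2 s3)
    hence "birkhoff_sum f N \<omega> = birkhoff_sum f p (periodic_seq v) + birkhoff_sum f (N - p) \<omega>'"
      using p by simp
    also have "\<dots> \<le> real p * M + (real (N - p) * M + 2 ^ k * D)"
      using cyc[OF v(2)] v p by (intro add_mono less.IH) auto
    also have "\<dots> = real N * M + 2 ^ k * D" using p by (simp add: of_nat_diff algebra_simps)
    finally show ?thesis .
  qed
qed

text \<open>Among the finitely many cycles of length at most \<open>2 ^ k\<close> one has the
  largest mean; excision of cycles makes this mean a bound for all orbits, up to a constant.\<close>

lemma maximizing_periodic_seq: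
  assumes dep: "depends_on_first k f"
  obtains v M D where "v \<noteq> []" "birkhoff_sum f (length v) (periodic_seq v) = real (length v) * M"
    "\<forall>N \<omega>. birkhoff_sum f N \<omega> \<le> real N * M + D"
proof -
  obtain B where B0: "B \<ge> 0" "\<forall>\<omega>. \<bar>f \<omega>\<bar> \<le> B" using depends_on_first_bounded[OF dep] .
  note B = B0(1) B0(2)[rule_format]
  define A where "A = {v :: bool list. v \<noteq> [] \<and> length v \<le> 2 ^ k}"
  define \<mu> where "\<mu> v = birkhoff_sum f (length v) (periodic_seq v) / real (length v)" for v
  have "finite A"
    using finite_lists_length_le[of "UNIV :: bool set" "2 ^ k"] by (rule rev_finite_subset) (auto simp: A_def)
  moreover have "[True] \<in> A" by (simp add: A_def)
  ultimately have "Max (\<mu> ` A) \<in> \<mu> ` A" by (intro Max_in) auto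
  then obtain v where v: "v \<in> A" "Max (\<mu> ` A) = \<mu> v" by blast
  have max: "\<mu> u \<le> \<mu> v" if "u \<in> A" for u
    using \<open>finite A\<close> that by (simp flip: v(2))
  show ?thesis
  proof (rule that)
    show "v \<noteq> []" using v by (simp add: A_def)
    thus "birkhoff_sum f (length v) (periodic_seq v) = real (length v) * \<mu> v"
      by (simp add: \<mu>_def)
    show "\<forall>N \<omega>. birkhoff_sum f N \<omega> \<le> real N * \<mu> v + 2 ^ k * (B + \<bar>\<mu> v\<bar>)"
    proof (intro allI birkhoff_sum_le_cycle_mean[OF dep])
      show "birkhoff_sum f (length u) (periodic_seq u) \<le> real (length u) * \<mu> v"
        if "u \<noteq> []" "length u \<le> 2 ^ k" for u
        using max[of u] that by (simp add: A_def \<mu>_def field_simps)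
      show "f \<omega> \<le> \<mu> v + (B + \<bar>\<mu> v\<bar>)" for \<omega> using B(2)[of \<omega>] by linarith
    qed (use B in auto)
  qed
qed

subsection \<open>Perturbing a periodic sequence\<close>

text \<open>Inequality of truth values serves as exclusive or.\<close>

definition flip_blocks :: "nat \<Rightarrow> binseq \<Rightarrow> (nat \<Rightarrow> bool) \<Rightarrow> binseq" where
  "flip_blocks L a y = Binseq (\<lambda>i. coord a i \<noteq> (i mod L = L - 1 \<and> y (i div L)))"

text \<open>A window of length \<open>k < L\<close> that starts in a block ends before the last
  letter of the next block, so the only flip it can contain is that of its own block.\<close>

lemma shift_flip_blocks:
  assumes dep: "depends_on_first k f" and L: "k < L"
    and per: "\<And>i. coord a (i mod L) = coord a i"
  shows "f ((shift ^^ n) (flip_blocks L a y)) =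
    f ((shift ^^ (n mod L)) (flip_blocks L a (\<lambda>_. y (n div L))))"
proof (rule depends_on_firstD[OF dep])
  fix i assume i: "i < k"
  have a: "coord a (n + i) = coord a (n mod L + i)"
    using per[of "n + i"] per[of "n mod L + i"] by (simp add: mod_add_left_eq)
  have "(n + i) div L = n div L" if e: "(n mod L + i) mod L = L - 1"
  proof -
    have nl: "n mod L < L" using L by simp
    have "n mod L + i < L"
    proof (rule ccontr)
      assume "\<not> n mod L + i < L"
      hence "(n mod L + i) mod L = n mod L + i - L"
        using nl i L by (subst le_mod_geq) (simp, rule mod_less, linarith)
      thus False using e nl i L by linarith
    qed
    moreover have "n + i = (n mod L + i) + n div L * L" by simp
    ultimately show ?thesis using L by (metis add.right_neutral div_less div_mult_self1 gr_implies_not0)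
  qed
  thus "coord ((shift ^^ n) (flip_blocks L a y)) i =
      coord ((shift ^^ (n mod L)) (flip_blocks L a (\<lambda>_. y (n div L)))) i"
    by (auto simp: flip_blocks_def a mod_add_left_eq)
qed

text \<open>By \<open>shift_flip_blocks\<close> each block contributes one of two values, according
  to whether it is flipped, whatever its neighbours are.\<close>

lemma birkhoff_sum_flip_blocks:
  assumes dep: "depends_on_first k f" and L: "k < L"
    and per: "\<And>i. coord a (i mod L) = coord a i"
  shows "birkhoff_sum f (J * L) (flip_blocks L a y) = real J * birkhoff_sum f L a -
    (birkhoff_sum f L a - birkhoff_sum f L (flip_blocks L a (\<lambda>_. True))) * real (card {j. j < J \<and> y j})"
proof -
  let ?s = "\<lambda>b. birkhoff_sum f L (flip_blocks L a (\<lambda>_. b))"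
  have [simp]: "flip_blocks L a (\<lambda>_. False) = a" by (simp add: flip_blocks_def coord_inverse)
  have "birkhoff_sum f (J * L) (flip_blocks L a y) =
      (\<Sum>j<J. \<Sum>n\<in>{j * L..<j * L + L}. f ((shift ^^ n) (flip_blocks L a y)))"
    unfolding birkhoff_sum_def by (rule sum.nat_group[symmetric])
  also have "\<dots> = (\<Sum>j<J. ?s (y j))"
  proof (rule sum.cong[OF refl])
    fix j
    have "(\<Sum>n\<in>{j * L..<j * L + L}. f ((shift ^^ n) (flip_blocks L a y))) =
        (\<Sum>n<L. f ((shift ^^ (n + j * L)) (flip_blocks L a y)))"
      using sum.shift_bounds_nat_ivl[of "\<lambda>n. f ((shift ^^ n) (flip_blocks L a y))" 0 "j * L" L]
      by (simp add: atLeast0LessThan add_ac)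
    also have "\<dots> = ?s (y j)"
      unfolding birkhoff_sum_def
    proof (rule sum.cong[OF refl])
      fix n assume "n \<in> {..<L}"
      thus "f ((shift ^^ (n + j * L)) (flip_blocks L a y)) = f ((shift ^^ n) (flip_blocks L a (\<lambda>_. y j)))"
        by (subst shift_flip_blocks[OF dep L per]) auto
    qed
    finally show "(\<Sum>n\<in>{j * L..<j * L + L}. f ((shift ^^ n) (flip_blocks L a y))) = ?s (y j)" .
  qed
  also have "\<dots> = (\<Sum>j<J. ?s False - (?s False - ?s True) * of_bool (y j))"
    by (intro sum.cong) auto
  also have "\<dots> = real J * ?s False - (?s False - ?s True) * (\<Sum>j<J. of_bool (y j))"
    by (simp add: sum_subtractf sum_distrib_left)
  also have "(\<Sum>j<J. of_bool (y j) :: real) = real (card {j. j < J \<and> y j})"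
    by (simp add: of_bool_def sum.If_cases Int_def)
  finally show ?thesis by simp
qed

text \<open>The deviation from linear growth stays bounded: the number of flips is off by at most 1,
  and the incomplete last block has fewer than \<open>L\<close> terms. The case \<open>q = 0\<close>
  without flips is included.\<close>

lemma flip_blocks_mem_birkhoff_level:
  assumes dep: "depends_on_first k f" and L: "k < L"
    and per: "\<And>i. coord a (i mod L) = coord a i"
    and \<alpha>: "birkhoff_sum f L a = real L * \<alpha>"
    and c: "c = birkhoff_sum f L a - birkhoff_sum f L (flip_blocks L a (\<lambda>_. True))"
    and freq: "\<And>J. \<bar>real (card {j. j < J \<and> y j}) - q * real J\<bar> \<le> 1"
  shows "flip_blocks L a y \<in> birkhoff_level f (\<alpha> - c * q / real L)"
proof -
  obtain B where B0: "B \<ge> 0" "\<forall>\<omega>. \<bar>f \<omega>\<bar> \<le> B" using depends_on_first_bounded[OF dep] .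
  note B = B0(1) B0(2)[rule_format]
  let ?x = "flip_blocks L a y" and ?\<beta> = "\<alpha> - c * q / real L"
  show ?thesis
  proof (rule mem_birkhoff_levelI[OF B(2)])
    fix N
    define J r where "J = N div L" and "r = N mod L"
    have N: "N = J * L + r" and r: "r \<le> L"
      using L by (auto simp: J_def r_def intro: less_imp_le)
    define K where "K = real (card {j. j < J \<and> y j})"
    have "birkhoff_sum f N ?x = birkhoff_sum f (J * L) ?x + (\<Sum>n<r. f ((shift ^^ (J * L + n)) ?x))"
      unfolding N birkhoff_sum_def by (induction r) auto
    also have "birkhoff_sum f (J * L) ?x = real J * (real L * \<alpha>) - c * K"
      unfolding birkhoff_sum_flip_blocks[OF dep L per] \<alpha>[symmetric] c K_def ..
    finally have sum_N: "birkhoff_sum f N ?x =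
        real J * (real L * \<alpha>) - c * K + (\<Sum>n<r. f ((shift ^^ (J * L + n)) ?x))" .
    have "real L * ?\<beta> = real L * \<alpha> - c * q" using L by (simp add: field_simps)
    moreover have "real N * ?\<beta> = real J * (real L * ?\<beta>) + real r * ?\<beta>"
      by (simp only: N of_nat_add of_nat_mult distrib_right mult.assoc)
    ultimately have "birkhoff_sum f N ?x - real N * ?\<beta> =
        c * (q * real J - K) + (\<Sum>n<r. f ((shift ^^ (J * L + n)) ?x)) - real r * ?\<beta>"
      unfolding sum_N by (simp only: right_diff_distrib) (simp add: mult_ac)
    also have "\<bar>\<dots>\<bar> \<le> \<bar>c * (q * real J - K)\<bar> + \<bar>\<Sum>n<r. f ((shift ^^ (J * L + n)) ?x)\<bar> + \<bar>real r * ?\<beta>\<bar>"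
      by (rule order.trans[OF abs_triangle_ineq4 add_right_mono[OF abs_triangle_ineq]])
    also have "\<bar>c * (q * real J - K)\<bar> \<le> \<bar>c\<bar> * 1"
      unfolding abs_mult using freq[of J] by (intro mult_left_mono) (auto simp: K_def abs_minus_commute)
    also have "\<bar>\<Sum>n<r. f ((shift ^^ (J * L + n)) ?x)\<bar> \<le> (\<Sum>n<r. B)"
      by (rule order.trans[OF sum_abs]) (intro sum_mono B)
    also have "\<dots> \<le> real L * B" using r B by (simp add: mult_right_mono)
    also have "\<bar>real r * ?\<beta>\<bar> \<le> real L * \<bar>?\<beta>\<bar>" unfolding abs_mult using r by (intro mult_mono) auto
    finally show "\<bar>birkhoff_sum f N ?x - real N * ?\<beta>\<bar> \<le> \<bar>c\<bar> * 1 + real L * B + real L * \<bar>?\<beta>\<bar>"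
      by simp
  qed
qed

section \<open>Coding numbers by sparse sequences of flips\<close>

text \<open>For \<open>x\<close> in \<open>[0, 1)\<close> this is the base-\<open>2 ^ m\<close>
  digit of weight \<open>2 ^ -(m * (j + 1))\<close>.\<close>

definition digit :: "nat \<Rightarrow> real \<Rightarrow> nat \<Rightarrow> nat" where
  "digit m x j = nat \<lfloor>x * real (2 ^ m) ^ Suc j\<rfloor> mod 2 ^ m"

definition mark :: "real \<Rightarrow> nat \<Rightarrow> real \<Rightarrow> nat \<Rightarrow> nat" where
  "mark q m x j = nat \<lfloor>real j / q\<rfloor> + digit m x j"

text \<open>The sequence has exactly one 1 in each interval \<open>[\<lfloor>j / q\<rfloor>, \<lfloor>(j + 1) / q\<rfloor>)\<close>, at the place
  given by the \<open>j\<close>-th digit of \<open>x\<close> in base \<open>2\<^sup>m\<close>; hence the density of 1s is \<open>q\<close>.\<close>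

definition sparse_seq :: "real \<Rightarrow> nat \<Rightarrow> real \<Rightarrow> nat \<Rightarrow> bool" where
  "sparse_seq q m x n \<longleftrightarrow> (\<exists>j. n = mark q m x j)"

text \<open>Since \<open>1 / q \<ge> 2 ^ m\<close>, the integer parts of \<open>j / q\<close> and
  \<open>(j + 1) / q\<close> differ by at least \<open>2 ^ m\<close>, which leaves room for every
  digit.\<close>

lemma mark_bounds:
  assumes q: "0 < q" "q \<le> 1 / 2 ^ m"
  shows "nat \<lfloor>real j / q\<rfloor> \<le> mark q m x j" "mark q m x j < nat \<lfloor>real (Suc j) / q\<rfloor>"
proof -
  show "nat \<lfloor>real j / q\<rfloor> \<le> mark q m x j" by (simp add: mark_def)
  have "real (2 ^ m) \<le> 1 / q" using q by (simp add: field_simps)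
  hence "real j / q + real (2 ^ m) \<le> real (Suc j) / q" by (simp add: add_divide_distrib)
  hence "\<lfloor>real j / q\<rfloor> + 2 ^ m \<le> \<lfloor>real (Suc j) / q\<rfloor>" by (simp add: le_floor_iff) linarith
  moreover have "\<lfloor>real j / q\<rfloor> \<ge> 0" using q by simp
  ultimately have "int (nat \<lfloor>real j / q\<rfloor> + 2 ^ m) \<le> int (nat \<lfloor>real (Suc j) / q\<rfloor>)"
    using zero_le_power[of "2 :: int" m]
    by (simp only: of_nat_add of_nat_power of_nat_numeral int_nat_eq split: if_split) linarith
  hence "nat \<lfloor>real j / q\<rfloor> + 2 ^ m \<le> nat \<lfloor>real (Suc j) / q\<rfloor>" by (simp only: of_nat_le_iff)
  moreover have "digit m x j < 2 ^ m" by (simp add: digit_def)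
  ultimately show "mark q m x j < nat \<lfloor>real (Suc j) / q\<rfloor>" by (simp add: mark_def)
qed

lemma strict_mono_mark:
  assumes q: "0 < q" "q \<le> 1 / 2 ^ m"
  shows "strict_mono (mark q m x)"
  unfolding strict_mono_Suc_iff using mark_bounds[OF q] order.strict_trans2 by blast

text \<open>By \<open>mark_bounds\<close>, mark \<open>j\<close> is below \<open>N\<close> if
  \<open>j + 1 \<le> q * N\<close>, and only if \<open>j < q * N\<close>. So the count lies between
  the floor and the ceiling of \<open>q * N\<close>.\<close>

lemma sparse_seq_frequency:
  assumes q: "0 < q" "q \<le> 1 / 2 ^ m"
  shows "\<bar>real (card {n. n < N \<and> sparse_seq q m x n}) - q * real N\<bar> \<le> 1"
proof -
  let ?J = "{j. mark q m x j < N}"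
  have "{n. n < N \<and> sparse_seq q m x n} = mark q m x ` ?J" by (auto simp: sparse_seq_def)
  hence eq: "card {n. n < N \<and> sparse_seq q m x n} = card ?J"
    using strict_mono_mark[OF q] by (simp add: card_image strict_mono_imp_inj_on inj_on_subset[OF _ subset_UNIV])
  have lower: "{..<nat \<lfloor>q * real N\<rfloor>} \<subseteq> ?J"
  proof safe
    fix j assume "j < nat \<lfloor>q * real N\<rfloor>"
    hence "real (Suc j) \<le> q * real N" by (simp add: le_floor_iff) linarith
    hence "real (Suc j) / q \<le> real N" using q by (simp add: field_simps)
    hence "nat \<lfloor>real (Suc j) / q\<rfloor> \<le> N" by linarith
    thus "mark q m x j < N" using mark_bounds(2)[OF q] order.strict_trans2 by blast
  qed
  have upper: "?J \<subseteq> {..<nat \<lceil>q * real N\<rceil>}"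
  proof safe
    fix j assume "mark q m x j < N"
    hence "nat \<lfloor>real j / q\<rfloor> < N" using mark_bounds(1)[OF q] order.strict_trans1 by blast
    hence "real j / q < real N" by linarith
    hence "real j < q * real N" using q by (simp add: field_simps)
    thus "j < nat \<lceil>q * real N\<rceil>" by linarith
  qed
  have "nat \<lfloor>q * real N\<rfloor> \<le> card ?J" "card ?J \<le> nat \<lceil>q * real N\<rceil>"
    using card_mono[OF finite_subset[OF upper] lower] card_mono[OF _ upper] by auto
  moreover have "q * real N \<ge> 0" using q by simp
  ultimately show ?thesis unfolding eq by linarith
qed

text \<open>If the digits first differ at index \<open>J\<close>, the sequences differ within the
  first \<open>L * (J + 1) / q\<close> letters. The exponent turns this into a lower bound
  \<open>2 ^ -(m * (J + 1))\<close>, while \<open>J\<close> equal digits give closeness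
  \<open>2 ^ -(m * J)\<close>; the factor \<open>2 ^ m\<close> pays for the missing digit.\<close>

lemma sparse_seq_Hoelder:
  assumes q: "0 < q" "q \<le> 1 / 2 ^ m" and m: "m > 0" and L: "L > 0"
    and x: "x \<in> {0..<1}" and y: "y \<in> {0..<1}"
  shows "\<bar>x - y\<bar> \<le> 2 ^ m *
    dist (flip_blocks L a (sparse_seq q m x)) (flip_blocks L a (sparse_seq q m y)) powr (real m * q / real L)"
    (is "_ \<le> _ * ?d powr ?s")
proof (cases "\<forall>j. digit m x j = digit m y j")
  case True
  have close: "\<bar>x - y\<bar> \<le> 1 / real (2 ^ m) ^ J" for J
    using True by (intro digits_agree_imp_close x y) (auto simp: digit_def)
  have "(\<lambda>J. (1 / real (2 ^ m)) ^ J) \<longlonglongrightarrow> 0"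
    using m by (intro LIMSEQ_realpow_zero) auto
  hence "\<bar>x - y\<bar> \<le> 0"
    by (rule LIMSEQ_le_const) (use close in \<open>auto simp: power_one_over\<close>)
  thus ?thesis by simp
next
  case False
  define J where "J = (LEAST j. digit m x j \<noteq> digit m y j)"
  have J: "digit m x J \<noteq> digit m y J" using False unfolding J_def by (metis (mono_tags, lifting) LeastI)
  have below: "digit m x j = digit m y j" if "j < J" for j
    using that not_less_Least unfolding J_def by blast
  have close: "\<bar>x - y\<bar> \<le> 1 / real (2 ^ m) ^ J"
    using below by (intro digits_agree_imp_close x y) (auto simp: digit_def)
  \<comment> \<open>Marks of \<open>y\<close> with index other than \<open>J\<close> lie in other
    intervals, and mark \<open>J\<close> differs because the digit does.\<close>
  have neq: "\<not> sparse_seq q m y (mark q m x J)"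
  proof
    assume "sparse_seq q m y (mark q m x J)"
    then obtain j where j: "mark q m x J = mark q m y j" by (auto simp: sparse_seq_def)
    have t: "nat \<lfloor>real u / q\<rfloor> \<le> nat \<lfloor>real v / q\<rfloor>" if "u \<le> v" for u v
      using that q by (intro nat_mono floor_mono divide_right_mono) auto
    have "\<not> J < j" using t[of "Suc J" j] mark_bounds(2)[OF q, of x J] mark_bounds(1)[OF q, of j y] j by auto
    moreover have "\<not> j < J" using t[of "Suc j" J] mark_bounds(2)[OF q, of y j] mark_bounds(1)[OF q, of J x] j by auto
    ultimately have "j = J" by simp
    thus False using j J by (simp add: mark_def)
  qed
  define i where "i = (L - 1) + mark q m x J * L"
  have "i div L = mark q m x J" unfolding i_def by (subst div_mult_self1) (use L in auto)
  moreover have "i mod L = L - 1" unfolding i_def by (subst mod_mult_self1) (use L in auto)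
  ultimately have "coord (flip_blocks L a (sparse_seq q m x)) i \<noteq> coord (flip_blocks L a (sparse_seq q m y)) i"
    using neq by (auto simp: flip_blocks_def sparse_seq_def)
  hence d: "(1 / 2) ^ Suc i \<le> ?d" by (rule dist_binseq_ge)
  have "Suc i = Suc (mark q m x J) * L" using L by (simp add: i_def)
  also have "\<dots> \<le> nat \<lfloor>real (Suc J) / q\<rfloor> * L"
    using mark_bounds(2)[OF q] by (intro mult_right_mono) (auto simp: Suc_le_eq)
  finally have "real (Suc i) \<le> real (nat \<lfloor>real (Suc J) / q\<rfloor>) * real L"
    by (metis of_nat_le_iff of_nat_mult)
  also have "\<dots> \<le> real (Suc J) / q * real L"
    using q by (intro mult_right_mono of_nat_floor) auto
  finally have "real (Suc i) * ?s \<le> real (Suc J) / q * real L * ?s"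
    using q by (intro mult_right_mono) auto
  also have "\<dots> = real m * real (Suc J)" using q L by (simp add: field_simps)
  finally have i: "real (Suc i) * ?s \<le> real m * real (Suc J)" .
  have "2 powr (- (real m * real (Suc J))) = inverse (2 ^ (m * Suc J))"
    by (simp only: powr_minus powr_realpow zero_less_numeral flip: of_nat_mult)
  hence "1 / real (2 ^ m) ^ J = 2 ^ m * 2 powr (- (real m * real (Suc J)))"
    by (simp add: power_add field_simps flip: power_mult)
  also have "\<dots> \<le> 2 ^ m * 2 powr (- (real (Suc i) * ?s))" using i by simp
  also have "2 powr (- (real (Suc i) * ?s)) = ((1 / 2) ^ Suc i) powr ?s"
    by (simp add: powr_powr powr_minus_divide powr_divide flip: powr_realpow del: power_Suc)
  also have "\<dots> \<le> ?d powr ?s" using d q by (intro powr_mono2) auto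
  finally show ?thesis using close by simp
qed

text \<open>All coded sequences have the same average, so the coding maps the unit interval into one
  level set. Non-emptiness is recorded for comparing this average with the maximal one.\<close>

lemma birkhoff_spectrum_lower_bound:
  assumes "depends_on_first k f" and L: "k < L"
    and "\<And>i. coord a (i mod L) = coord a i"
    and "birkhoff_sum f L a = real L * \<alpha>"
    and "c = birkhoff_sum f L a - birkhoff_sum f L (flip_blocks L a (\<lambda>_. True))"
    and q: "0 < q" "q \<le> 1 / 2 ^ m" and m: "m > 0"
  shows "real m * q / real L \<le> birkhoff_spectrum f (\<alpha> - c * q / real L)"
    and "birkhoff_level f (\<alpha> - c * q / real L) \<noteq> {}"
proof -
  let ?E = "birkhoff_level f (\<alpha> - c * q / real L)"
  have mem: "flip_blocks L a (sparse_seq q m x) \<in> ?E" for x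
    by (rule flip_blocks_mem_birkhoff_level[OF assms(1-5)]) (rule sparse_seq_frequency[OF q])
  thus "?E \<noteq> {}" by blast
  have "ereal (real m * q / real L) \<le> hausdorff_dim ?E"
  proof (rule hausdorff_dim_ge_Hoelder[where C = "2 ^ m"])
    show "(\<lambda>x. flip_blocks L a (sparse_seq q m x)) ` {0..<1} \<subseteq> ?E" using mem by blast
  qed (use sparse_seq_Hoelder[OF q m] L in auto)
  thus "real m * q / real L \<le> birkhoff_spectrum f (\<alpha> - c * q / real L)"
    unfolding birkhoff_spectrum_def
    using hausdorff_dim_binseq[of ?E] by (cases "hausdorff_dim ?E") auto
qed

subsection \<open>The spectrum at its end points\<close>

text \<open>Beyond \<open>alpha_max f\<close> the level sets are empty, so the limit of the spectrum
  from the right is 0.\<close>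

lemma birkhoff_spectrum_alpha_max_eq_0:
  assumes "f \<in> PCC" and "continuous_on UNIV (birkhoff_spectrum f)"
  shows "birkhoff_spectrum f (alpha_max f) = 0"
proof -
  have "birkhoff_spectrum f \<beta> = 0" if "\<beta> > alpha_max f" for \<beta>
  proof -
    have "birkhoff_level f \<beta> = {}"
      using that cSup_upper[OF _ attained_averages(2)[OF assms(1)], of \<beta>] by (force simp: alpha_max_def)
    thus ?thesis by (simp add: birkhoff_spectrum_def hausdorff_dim_empty)
  qed
  hence "(birkhoff_spectrum f \<longlongrightarrow> 0) (at_right (alpha_max f))"
    by (intro tendsto_eventually) (auto simp: eventually_at_right_less intro: eventually_mono[OF eventually_at_right_less])
  moreover have "(birkhoff_spectrum f \<longlongrightarrow> birkhoff_spectrum f (alpha_max f)) (at_right (alpha_max f))"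
    using assms(2) by (auto simp: continuous_on_def intro: tendsto_within_subset)
  ultimately show ?thesis by (metis tendsto_unique trivial_limit_at_right_real)
qed

lemma PCC_depends_on_first:
  assumes "f \<in> PCC" obtains k where "depends_on_first k f"
  using assms unfolding PCC_def PCCk_def depends_on_first_def by blast

lemma has_left_derivative_alpha_max:
  assumes f: "f \<in> PCC" and cont: "continuous_on UNIV (birkhoff_spectrum f)"
  shows "has_left_derivative (birkhoff_spectrum f) (-\<infinity>) (alpha_max f)"
proof -
  obtain k where dep: "depends_on_first k f" using PCC_depends_on_first[OF f] .
  obtain v M D where v: "v \<noteq> []" "birkhoff_sum f (length v) (periodic_seq v) = real (length v) * M"
    and max: "\<forall>N \<omega>. birkhoff_sum f N \<omega> \<le> real N * M + D"
    using maximizing_periodic_seq[OF dep] .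
  obtain B where B0: "B \<ge> 0" "\<forall>\<omega>. \<bar>f \<omega>\<bar> \<le> B" using depends_on_first_bounded[OF dep] .
  note B = B0(1) B0(2)[rule_format]
  \<comment> \<open>The factor \<open>Suc k\<close> keeps \<open>L\<close> a period and makes it
    exceed \<open>k\<close>.\<close>
  define a L where "a = periodic_seq v" and "L = Suc k * length v"
  have L: "k < L" using v(1) by (cases v) (auto simp: L_def)
  have per: "coord a (i mod L) = coord a i" for i
    by (simp add: a_def L_def periodic_seq_def mod_mult2_eq mod_mod_cancel)
  have "(shift ^^ length v) a = a"
    by (simp add: binseq_eq_iff a_def periodic_seq_def)
  hence "birkhoff_sum f (J * length v) a = real J * (real (length v) * M)" for J
    using v(2) by (induction J) (simp_all add: birkhoff_sum_add a_def algebra_simps, simp add: birkhoff_sum_def)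
  from this[of "Suc k"] have sum_a: "birkhoff_sum f L a = real L * M" by (simp add: L_def algebra_simps)
  define c where "c = birkhoff_sum f L a - birkhoff_sum f L (flip_blocks L a (\<lambda>_. True))"
  note lower = birkhoff_spectrum_lower_bound[OF dep L per sum_a c_def]
  have level_le: "\<alpha> \<le> M" if "birkhoff_level f \<alpha> \<noteq> {}" for \<alpha>
    using that birkhoff_level_le[OF B(2) max[rule_format]] by blast
  \<comment> \<open>With no block flipped, \<open>a\<close> itself attains the bound
    \<open>M\<close>.\<close>
  have "flip_blocks L a (\<lambda>_. False) \<in> birkhoff_level f (M - c * 0 / real L)"
    by (rule flip_blocks_mem_birkhoff_level[OF dep L per sum_a c_def]) auto
  hence "alpha_max f = M"
    unfolding alpha_max_def using level_le by (intro cSup_eq_maximum) auto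
  hence S0: "birkhoff_spectrum f M = 0" using birkhoff_spectrum_alpha_max_eq_0[OF f cont] by simp
  \<comment> \<open>Taking \<open>q = 1 / 2\<close>, the average \<open>M - c / (2 * L)\<close> is
    attained, so it is at most \<open>M\<close>. If \<open>c\<close> were 0, the lower bound would
    make the spectrum at \<open>M\<close> positive.\<close>
  have "c > 0"
  proof (rule ccontr)
    assume "\<not> c > 0"
    moreover have "c \<ge> 0"
      using level_le[OF lower(2)[of "1 / 2" 1]] L by (simp add: field_simps)
    ultimately have "c = 0" by simp
    thus False using lower(1)[of "1 / 2" 1] S0 L by (simp add: field_simps)
  qed
  show ?thesis
    unfolding has_left_derivative_def \<open>alpha_max f = M\<close> S0 tendsto_MInfty
  proof
    fix r :: real
    obtain m :: nat where m: "m > \<bar>r\<bar> * c" using reals_Archimedean2 by blast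
    have m0: "m > 0" using m \<open>c > 0\<close> by (cases m) (auto simp: mult_less_0_iff)
    \<comment> \<open>This is the distance from \<open>M\<close> belonging to the density
      \<open>2 ^ -m\<close>. For \<open>\<beta>\<close> closer to \<open>M\<close>, the density
      \<open>q\<close> solving \<open>M - c * q / L = \<beta>\<close> is smaller, so the lower bound
      applies with this \<open>m\<close>.\<close>
    define \<epsilon> where "\<epsilon> = c / real L / 2 ^ m"
    have "\<epsilon> > 0" using \<open>c > 0\<close> L by (simp add: \<epsilon>_def)
    hence "eventually (\<lambda>\<beta>. \<beta> \<in> {M - \<epsilon><..<M}) (at_left M)"
      by (intro eventually_at_left_real) auto
    thus "eventually (\<lambda>\<beta>. ereal ((birkhoff_spectrum f \<beta> - 0) / (\<beta> - M)) < ereal r) (at_left M)"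
    proof eventually_elim
      case (elim \<beta>)
      define q where "q = (M - \<beta>) * real L / c"
      have "real m * q / real L \<le> birkhoff_spectrum f (M - c * q / real L)"
        using elim \<open>c > 0\<close> L m0 by (intro lower) (auto simp: q_def \<epsilon>_def field_simps)
      also have "M - c * q / real L = \<beta>" using \<open>c > 0\<close> L by (simp add: q_def)
      also have "real m * q / real L = real m / c * (M - \<beta>)" using \<open>c > 0\<close> L by (simp add: q_def)
      finally have "real m / c \<le> birkhoff_spectrum f \<beta> / (M - \<beta>)"
        using elim by (simp add: pos_le_divide_eq)
      moreover have "\<bar>r\<bar> < real m / c" using m \<open>c > 0\<close> by (simp add: pos_less_divide_eq)
      moreover have "birkhoff_spectrum f \<beta> / (\<beta> - M) = - (birkhoff_spectrum f \<beta> / (M - \<beta>))"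
        by (metis minus_diff_eq divide_minus_right)
      ultimately show ?case by simp
    qed
  qed
qed

section \<open>Reduction of the minimum to the maximum\<close>

lemma birkhoff_level_uminus: "birkhoff_level (\<lambda>\<omega>. - f \<omega>) \<alpha> = birkhoff_level f (- \<alpha>)"
  unfolding birkhoff_level_def
proof (rule Collect_cong)
  show "(\<lambda>N. (1 / real N) * (\<Sum>n=1..N. - f ((shift ^^ n) \<omega>))) \<longlonglongrightarrow> \<alpha> \<longleftrightarrow>
      (\<lambda>N. (1 / real N) * (\<Sum>n=1..N. f ((shift ^^ n) \<omega>))) \<longlonglongrightarrow> - \<alpha>" for \<omega>
    using tendsto_minus_cancel_left[of "\<lambda>N. (1 / real N) * (\<Sum>n=1..N. f ((shift ^^ n) \<omega>))" \<alpha> sequentially]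
    by (simp add: sum_negf)
qed

lemma birkhoff_spectrum_uminus: "birkhoff_spectrum (\<lambda>\<omega>. - f \<omega>) \<alpha> = birkhoff_spectrum f (- \<alpha>)"
  by (simp add: birkhoff_spectrum_def birkhoff_level_uminus)

lemma alpha_max_uminus: "alpha_max (\<lambda>\<omega>. - f \<omega>) = - alpha_min f"
proof -
  have "{\<alpha>. birkhoff_level (\<lambda>\<omega>. - f \<omega>) \<alpha> \<noteq> {}} = uminus ` {\<alpha>. birkhoff_level f \<alpha> \<noteq> {}}"
    unfolding birkhoff_level_uminus by (force simp: image_iff intro: exI[of _ "- _"])
  thus ?thesis by (simp add: alpha_max_def alpha_min_def Inf_real_def)
qed

theorem theorem5p2p6:
  fixes f :: "binseq \<Rightarrow> real"
  assumes "f \<in> PCC"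
    and "continuous_on UNIV (birkhoff_spectrum f)"
  shows "has_left_derivative (birkhoff_spectrum f) (-\<infinity>) (alpha_max f) \<and>
         has_right_derivative (birkhoff_spectrum f) \<infinity> (alpha_min f)"
proof
  show "has_left_derivative (birkhoff_spectrum f) (-\<infinity>) (alpha_max f)"
    using assms by (rule has_left_derivative_alpha_max)
  let ?g = "\<lambda>\<omega>. - f \<omega>" and ?S = "birkhoff_spectrum f"
  have "?g \<in> PCC" using assms(1) by (fastforce simp: PCC_def PCCk_def intro: continuous_on_minus)
  moreover have "continuous_on UNIV (birkhoff_spectrum ?g)"
    unfolding birkhoff_spectrum_uminus
    by (rule continuous_on_compose2[OF assms(2)]) (auto intro: continuous_intros)
  ultimately have "has_left_derivative (birkhoff_spectrum ?g) (-\<infinity>) (- alpha_min f)"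
    using has_left_derivative_alpha_max[of ?g] by (simp add: alpha_max_uminus)
  hence "((\<lambda>\<beta>. ereal ((?S (- \<beta>) - ?S (alpha_min f)) / (\<beta> + alpha_min f))) \<longlongrightarrow> -\<infinity>) (at_left (- alpha_min f))"
    by (simp add: has_left_derivative_def birkhoff_spectrum_uminus)
  \<comment> \<open>Reflection exchanges the one-sided neighbourhoods; the sign left over in the
    denominator then turns the limit into \<open>\<infinity>\<close>.\<close>
  hence "((\<lambda>\<beta>. ereal ((?S \<beta> - ?S (alpha_min f)) / (- \<beta> + alpha_min f))) \<longlongrightarrow> -\<infinity>) (at_right (alpha_min f))"
    by (simp add: at_left_minus filterlim_filtermap)
  hence "((\<lambda>\<beta>. - ereal ((?S \<beta> - ?S (alpha_min f)) / (- \<beta> + alpha_min f))) \<longlongrightarrow> - (-\<infinity>)) (at_right (alpha_min f))"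
    by (rule ereal_Lim_uminus[THEN iffD1])
  moreover have "- ereal (u / (- \<beta> + alpha_min f)) = ereal (u / (\<beta> - alpha_min f))" for u \<beta>
    by (metis add.commute diff_conv_add_uminus divide_minus_right minus_diff_eq uminus_ereal.simps(1))
  ultimately show "has_right_derivative ?S \<infinity> (alpha_min f)"
    by (simp add: has_right_derivative_def)
qed

end
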